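(* Let $G=(V,E)$ be a finite connected weighted graph with positive symmetric edge weights $\omega_{xy}$ and positive vertex measure $\mu$, let $N\ge 1$ be an integer and let $p_1,\dots,p_N\in V$ be distinct vertices. For $\lambda>0$ consider the Chern-Simons-Higgs equation $$\Delta u=\lambda e^{u}\left(e^{u}-1\right)+4\pi\sum_{j=1}^{N}\delta_{p_j}\quad\text{on } V,\qquad (\ast)_\lambda$$ for $u:V\to\mathbb{R}$. Let $\lambda_c$ be its critical value, i.e. the number $\lambda_c\geq \frac{16\pi N}{|V|}$ such that $(\ast)_\lambda$ has a solution if $\lambda>\lambda_c$ and has no solution if $0<\lambda<\lambda_c$. Then $(\ast)_\lambda$ has a solution when $\lambda=\lambda_c$.
   Context: $G=(V,E)$ is a finite connected graph: $V$ is a finite nonempty vertex set, $E$ the edge set, $y\sim x$ means $xy\in E$, and any two vertices can be joined by a finite chain of edges. Each edge $xy\in E$ has a weight $\omega_{xy}>0$ with $\omega_{xy}=\omega_{yx}$, and $\mu:V\to(0,\infty)$ is a measure. For $u:V\to\mathbb{R}$, the $\mu$-Laplacian is $\Delta u(x)=\frac{1}{\mu(x)}\sum_{y\sim x}\omega_{xy}(u(y)-u(x))$, and $\int_V u\,d\mu=\sum_{x\in V}\mu(x)u(x)$. The volume is $|V|=\sum_{x\in V}\mu(x)$. The Dirac mass $\delta_{p}$ at $p\in V$ is the function with $\delta_p(p)=1/\mu(p)$ and $\delta_p(x)=0$ for $x\ne p$, so that $\int_V\delta_p\,d\mu=1$. The existence of the critical value $\lambda_c$ with the stated properties is a known theorem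 of Huang, Lin and Yau (Comm. Math. Phys. 377 (2020)); equivalently, $\lambda_c$ is the infimum of the set of $\lambda>0$ for which the equation has a solution. *)

theory Defs
  imports Complex_Main "Graph_Theory.Digraph_Component"
begin

text \<open>
  An undirected edge \<open>xy\<close> is represented by the two arcs \<open>(x, y)\<close> and \<open>(y, x)\<close>, both in
  \<open>parcs G\<close>. The locale \<open>pair_pseudo_graph\<close> requires finitely many vertices and a symmetric arc set;
  loops are not excluded, but they do not contribute to the Laplacian.
  \<open>Digraph_Component.connected\<close> includes that the vertex set is nonempty.
\<close>

locale connected_weighted_graph = pair_pseudo_graph G
  for G :: "'a pair_pre_digraph" +
  fixes \<omega> :: "'a \<Rightarrow> 'a \<Rightarrow> real"
    and \<mu> :: "'a \<Rightarrow> real"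
  assumes connected_graph: "Digraph_Component.connected (with_proj G)"
    and weight_pos: "(x, y) \<in> parcs G \<Longrightarrow> \<omega> x y > 0"
    and weight_sym: "(x, y) \<in> parcs G \<Longrightarrow> \<omega> x y = \<omega> y x"
    and measure_pos: "x \<in> pverts G \<Longrightarrow> \<mu> x > 0"

definition volume :: "'a pair_pre_digraph \<Rightarrow> ('a \<Rightarrow> real) \<Rightarrow> real" where
  "volume G \<mu> = (\<Sum>x\<in>pverts G. \<mu> x)"

definition laplacian ::
  "'a pair_pre_digraph \<Rightarrow> ('a \<Rightarrow> 'a \<Rightarrow> real) \<Rightarrow> ('a \<Rightarrow> real) \<Rightarrow> ('a \<Rightarrow> real) \<Rightarrow> 'a \<Rightarrow> real" where
  "laplacian G \<omega> \<mu> u x = 1 / \<mu> x * (\<Sum>y | (x, y) \<in> parcs G. \<omega> x y * (u y - u x))"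

definition dirac :: "('a \<Rightarrow> real) \<Rightarrow> 'a \<Rightarrow> 'a \<Rightarrow> real" where
  "dirac \<mu> p x = (if x = p then 1 / \<mu> p else 0)"

text \<open>
  A function on the vertex set is represented by a function \<open>u\<close> on the whole type; the values of
  \<open>u\<close> outside \<open>pverts G\<close> do not occur in the equation, since arcs end in \<open>pverts G\<close>.
\<close>

definition chern_simons_higgs_solution ::
  "'a pair_pre_digraph \<Rightarrow> ('a \<Rightarrow> 'a \<Rightarrow> real) \<Rightarrow> ('a \<Rightarrow> real) \<Rightarrow> nat \<Rightarrow> (nat \<Rightarrow> 'a) \<Rightarrow> real
    \<Rightarrow> ('a \<Rightarrow> real) \<Rightarrow> bool" where
  "chern_simons_higgs_solution G \<omega> \<mu> N p lam u \<longleftrightarrow>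
    (\<forall>x\<in>pverts G. laplacian G \<omega> \<mu> u x =
      lam * exp (u x) * (exp (u x) - 1) + 4 * pi * (\<Sum>j = 1..N. dirac \<mu> (p j) x))"

text \<open>
  At most one real number satisfies the following predicate when \<open>N \<ge> 1\<close> and the volume is
  positive, because the lower bound is then positive.
\<close>

definition is_critical_value ::
  "'a pair_pre_digraph \<Rightarrow> ('a \<Rightarrow> 'a \<Rightarrow> real) \<Rightarrow> ('a \<Rightarrow> real) \<Rightarrow> nat \<Rightarrow> (nat \<Rightarrow> 'a) \<Rightarrow> real \<Rightarrow> bool"
  where
  "is_critical_value G \<omega> \<mu> N p lam_c \<longleftrightarrow>
    16 * pi * real N / volume G \<mu> \<le> lam_c \<and>
    (\<forall>lam > lam_c. \<exists>u. chern_simons_higgs_solution G \<omega> \<mu> N p lam u) \<and>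
    (\<forall>lam. 0 < lam \<and> lam < lam_c \<longrightarrow> \<not> (\<exists>u. chern_simons_higgs_solution G \<omega> \<mu> N p lam u))"

end

theory Submission
  imports Defs
begin

text \<open>
  Solutions are nonpositive by the maximum principle, so their Laplacians are bounded from below.
  Integrating the equation shows that \<open>exp u\<close> cannot be uniformly small, so \<open>u\<close> is bounded
  from below at some vertex, and the lower bound on the Laplacian propagates this bound along the
  edges to all of the connected graph. Hence the solutions for all \<open>\<lambda>\<close> in a bounded range are
  uniformly bounded, and those for \<open>\<lambda> \<down> \<lambda>\<^sub>c\<close> subconverge to a solution for \<open>\<lambda>\<^sub>c\<close>.
\<close>

text \<open>Bolzano-Weierstrass, one coordinate at a time: each new point thins the subsequence to
  one that is monotone there, and convergence at the earlier points survives the thinning.\<close>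

lemma bounded_imp_convergent_subsequence_finite:
  fixes f :: "nat \<Rightarrow> 'a \<Rightarrow> real"
  assumes "finite A" and "\<And>x n. x \<in> A \<Longrightarrow> \<bar>f n x\<bar> \<le> B"
  shows "\<exists>r :: nat \<Rightarrow> nat. strict_mono r \<and> (\<forall>x\<in>A. convergent (\<lambda>n. f (r n) x))"
  using assms
proof (induction A rule: finite_induct)
  case empty
  show ?case using strict_mono_id by blast
next
  case (insert a A)
  then obtain r :: "nat \<Rightarrow> nat" where r: "strict_mono r" "\<And>x. x \<in> A \<Longrightarrow> convergent (\<lambda>n. f (r n) x)"
    by auto
  obtain s :: "nat \<Rightarrow> nat" where s: "strict_mono s" "monoseq (\<lambda>n. f (r (s n)) a)"
    using seq_monosub[of "\<lambda>n. f (r n) a"] by auto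
  have "Bseq (\<lambda>n. f (r (s n)) a)"
    using insert.prems by (intro BseqI'[where K = B]) auto
  then have "convergent (\<lambda>n. f (r (s n)) a)"
    using s(2) by (rule Bseq_monoseq_convergent)
  moreover have "convergent (\<lambda>n. f (r (s n)) x)" if "x \<in> A" for x
    using convergent_subseq_convergent[OF r(2)[OF that] s(1)] by (simp add: o_def)
  moreover have "strict_mono (r \<circ> s)"
    using r(1) s(1) by (rule strict_mono_o)
  ultimately show ?case
    by (intro exI[of _ "r \<circ> s"]) (auto simp: o_def)
qed

section \<open>Connectivity and integral identities for the Laplacian\<close>

context connected_weighted_graph
begin

lemma neighbours_subset: "{y. (x, y) \<in> parcs G} \<subseteq> pverts G"
  by (auto dest: in_arcsD2)

lemma finite_neighbours: "finite {y. (x, y) \<in> parcs G}"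
  using neighbours_subset pair_finite_verts by (rule finite_subset)

text \<open>Arcs come in both directions, so connectedness yields directed paths between all
  vertices; the lower bound will travel along these.\<close>

lemma strongly_connected_graph: "strongly_connected (with_proj G)"
  using sym_arcs connected_graph by (rule symmetric_connected_imp_strongly_connected)

lemma pverts_nonempty: "pverts G \<noteq> {}"
  using strongly_connected_graph by (auto simp: strongly_connected_def)

lemma reachable_pverts:
  assumes "x \<in> pverts G" and "y \<in> pverts G"
  shows "x \<rightarrow>\<^sup>*\<^bsub>with_proj G\<^esub> y"
  using strongly_connected_graph assms by (auto simp: strongly_connected_def)

lemma volume_pos: "volume G \<mu> > 0"
  unfolding volume_def using pair_finite_verts pverts_nonempty measure_pos by (rule sum_pos)

lemma measure_times_laplacian:
  assumes "x \<in> pverts G"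
  shows "\<mu> x * laplacian G \<omega> \<mu> u x = (\<Sum>y | (x, y) \<in> parcs G. \<omega> x y * (u y - u x))"
  using measure_pos[OF assms] by (simp add: laplacian_def)

lemma laplacian_nonpos_at_max:
  assumes "x \<in> pverts G" and "\<And>y. y \<in> pverts G \<Longrightarrow> u y \<le> u x"
  shows "laplacian G \<omega> \<mu> u x \<le> 0"
proof -
  have "(\<Sum>y | (x, y) \<in> parcs G. \<omega> x y * (u y - u x)) \<le> 0"
    using assms(2) in_arcsD2 weight_pos by (intro sum_nonpos mult_nonneg_nonpos) (auto simp: less_imp_le)
  then show ?thesis
    using measure_pos[OF assms(1)] by (simp add: laplacian_def divide_nonpos_pos)
qed

text \<open>The measure cancels and leaves a sum over all arcs. Reversing every arc keeps the weight
  and flips the sign of the difference, so the sum equals its own negative.\<close>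

lemma integral_laplacian: "(\<Sum>x\<in>pverts G. \<mu> x * laplacian G \<omega> \<mu> u x) = 0"
proof -
  define S where "S = (\<Sum>(x, y)\<in>parcs G. \<omega> x y * (u y - u x))"
  have "(\<Sum>x\<in>pverts G. \<mu> x * laplacian G \<omega> \<mu> u x)
      = (\<Sum>x\<in>pverts G. \<Sum>y | (x, y) \<in> parcs G. \<omega> x y * (u y - u x))"
    by (simp add: measure_times_laplacian)
  also have "\<dots> = (\<Sum>(x, y)\<in>(SIGMA x:pverts G. {y. (x, y) \<in> parcs G}). \<omega> x y * (u y - u x))"
    using pair_finite_verts finite_neighbours by (intro sum.Sigma) auto
  also have "(SIGMA x:pverts G. {y. (x, y) \<in> parcs G}) = parcs G"
    by (auto dest: in_arcsD1)
  finally have eq: "(\<Sum>x\<in>pverts G. \<mu> x * laplacian G \<omega> \<mu> u x) = S"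
    by (simp add: S_def)
  have "S = (\<Sum>(x, y)\<in>parcs G. \<omega> y x * (u x - u y))"
    unfolding S_def
    by (rule sum.reindex_bij_witness[where i = prod.swap and j = prod.swap])
      (auto intro: arcs_symmetric)
  also have "\<dots> = - S"
    unfolding S_def sum_negf[symmetric]
    by (intro sum.cong) (auto dest: weight_sym simp: algebra_simps)
  finally show ?thesis using eq by simp
qed

section \<open>Propagation of lower bounds through the graph\<close>

text \<open>A very negative \<open>u y\<close> would pull the Laplacian at \<open>x\<close> below
  \<open>- C\<close>, because the other neighbours can compensate only by a bounded amount.
  \<open>K'\<close> is quantified before \<open>u\<close>, which is what makes the final bounds
  uniform.\<close>

lemma neighbour_lower_bound:
  assumes arc: "(x, y) \<in> parcs G"
  shows "\<exists>K'. \<forall>u. (\<forall>z\<in>pverts G. u z \<le> 0 \<and> - C \<le> laplacian G \<omega> \<mu> u z) \<longrightarrow> - K \<le> u x \<longrightarrow> - K' \<le> u y"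
proof (intro exI allI impI)
  let ?A = "{z. (x, z) \<in> parcs G}"
  \<comment> \<open>Isolating the term of \<open>y\<close> in the Laplacian at \<open>x\<close>
    leaves \<open>C * \<mu> x\<close> from its lower bound and at most \<open>K\<close> per unit
    weight from each other neighbour, as \<open>u z - u x\<close> is at most
    \<open>0 + K\<close>.\<close>
  let ?D = "C * \<mu> x + (\<Sum>z\<in>?A - {y}. \<omega> x z * K)"
  fix u assume u: "\<forall>z\<in>pverts G. u z \<le> 0 \<and> - C \<le> laplacian G \<omega> \<mu> u z" and ux: "- K \<le> u x"
  have x: "x \<in> pverts G" using arc by (rule in_arcsD1)
  have w: "\<omega> x y > 0" using arc by (rule weight_pos)
  have "\<mu> x * (- C) \<le> \<mu> x * laplacian G \<omega> \<mu> u x"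
    using u x measure_pos by (intro mult_left_mono) (auto simp: less_imp_le)
  also have "\<dots> = \<omega> x y * (u y - u x) + (\<Sum>z\<in>?A - {y}. \<omega> x z * (u z - u x))"
    using arc by (simp add: measure_times_laplacian[OF x] sum.remove[OF finite_neighbours, of y])
  also have "(\<Sum>z\<in>?A - {y}. \<omega> x z * (u z - u x)) \<le> (\<Sum>z\<in>?A - {y}. \<omega> x z * K)"
  proof (intro sum_mono mult_left_mono)
    fix z assume "z \<in> ?A - {y}"
    then have z: "(x, z) \<in> parcs G" by simp
    show "0 \<le> \<omega> x z" using weight_pos[OF z] by simp
    show "u z - u x \<le> K" using u in_arcsD2[OF z] ux by fastforce
  qed
  finally have "- ?D \<le> \<omega> x y * (u y - u x)" by (simp add: algebra_simps)
  then have "- (?D / \<omega> x y) \<le> u y - u x"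
    using w by (simp only: minus_divide_left pos_divide_le_eq mult.commute)
  then show "- (K + ?D / \<omega> x y) \<le> u y" using ux by linarith
qed

text \<open>Induction along a path from \<open>x\<close>: each arc replaces the constant by a new
  one, still independent of \<open>u\<close>.\<close>

lemma reachable_lower_bound:
  assumes "x \<in> pverts G" and "y \<in> pverts G"
  shows "\<exists>K'. \<forall>u. (\<forall>z\<in>pverts G. u z \<le> 0 \<and> - C \<le> laplacian G \<omega> \<mu> u z) \<longrightarrow> - K \<le> u x \<longrightarrow> - K' \<le> u y"
  using reachable_pverts[OF assms]
proof (induction rule: reachable_induct)
  case base
  show ?case by blast
next
  case (step y z)
  from step.IH obtain K1 where K1: "\<forall>u. (\<forall>z\<in>pverts G. u z \<le> 0 \<and> - C \<le> laplacian G \<omega> \<mu> u z)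
      \<longrightarrow> - K \<le> u x \<longrightarrow> - K1 \<le> u y" by blast
  have "(y, z) \<in> parcs G" using step.hyps by simp
  from neighbour_lower_bound[OF this, of C K1] K1 show ?case by blast
qed

text \<open>The vertex where \<open>u\<close> is not too small may vary with \<open>u\<close>, so
  the constant is the maximum over all pairs of vertices, of which there are finitely many.\<close>

lemma uniform_lower_bound:
  "\<exists>B. \<forall>u. (\<forall>z\<in>pverts G. u z \<le> 0 \<and> - C \<le> laplacian G \<omega> \<mu> u z) \<longrightarrow> (\<exists>x\<in>pverts G. - K \<le> u x)
    \<longrightarrow> (\<forall>y\<in>pverts G. - B \<le> u y)"
proof -
  let ?Q = "\<lambda>u. \<forall>z\<in>pverts G. u z \<le> 0 \<and> - C \<le> laplacian G \<omega> \<mu> u z"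
  have "\<forall>x y. \<exists>K'. x \<in> pverts G \<longrightarrow> y \<in> pverts G \<longrightarrow>
      (\<forall>u. ?Q u \<longrightarrow> - K \<le> u x \<longrightarrow> - K' \<le> u y)"
    using reachable_lower_bound[of _ _ C K] by blast
  then obtain b where b: "\<And>x y u. x \<in> pverts G \<Longrightarrow> y \<in> pverts G \<Longrightarrow> ?Q u \<Longrightarrow> - K \<le> u x
      \<Longrightarrow> - b x y \<le> u y"
    by metis
  have fin: "finite ((\<lambda>(x, y). b x y) ` (pverts G \<times> pverts G))"
    using pair_finite_verts by simp
  show ?thesis
  proof (intro exI allI impI ballI)
    fix u y assume u: "?Q u" and ex: "\<exists>x\<in>pverts G. - K \<le> u x" and y: "y \<in> pverts G"
    from ex obtain x where x: "x \<in> pverts G" "- K \<le> u x" by blast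
    have "b x y \<le> Max ((\<lambda>(x, y). b x y) ` (pverts G \<times> pverts G))"
      using x(1) y fin by (intro Max_ge) auto
    with b[OF x(1) y u x(2)]
    show "- Max ((\<lambda>(x, y). b x y) ` (pverts G \<times> pverts G)) \<le> u y" by simp
  qed
qed

section \<open>A priori bounds for solutions\<close>

lemma dirac_sum_nonneg:
  fixes p :: "nat \<Rightarrow> 'a"
  assumes "x \<in> pverts G"
  shows "0 \<le> (\<Sum>j = 1..N. dirac \<mu> (p j) x)"
  using measure_pos[OF assms] by (intro sum_nonneg) (auto simp: dirac_def)

lemma integral_dirac:
  assumes "q \<in> pverts G"
  shows "(\<Sum>x\<in>pverts G. \<mu> x * dirac \<mu> q x) = 1"
proof -
  have "(\<Sum>x\<in>pverts G. \<mu> x * dirac \<mu> q x) = (\<Sum>x\<in>pverts G. if x = q then 1 else 0)"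
    using measure_pos by (intro sum.cong) (auto simp: dirac_def less_imp_neq[symmetric])
  then show ?thesis using assms pair_finite_verts by simp
qed

lemma solution_nonpos:
  assumes sol: "chern_simons_higgs_solution G \<omega> \<mu> N p lam u" and lam: "lam > 0" and x: "x \<in> pverts G"
  shows "u x \<le> 0"
proof -
  \<comment> \<open>At a maximum point the Laplacian is nonpositive and the Dirac terms are
    nonnegative, which forces \<open>exp (u m) - 1\<close> to be nonpositive.\<close>
  obtain m where m: "m \<in> pverts G" "\<And>y. y \<in> pverts G \<Longrightarrow> u y \<le> u m"
    using Max_in[of "u ` pverts G"] Max_ge[of "u ` pverts G"] pair_finite_verts pverts_nonempty
    by (metis (no_types, lifting) finite_imageI image_iff image_is_empty imageI)
  have "lam * exp (u m) * (exp (u m) - 1) + 4 * pi * (\<Sum>j = 1..N. dirac \<mu> (p j) m) \<le> 0"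
    using laplacian_nonpos_at_max[of m u, OF m] sol m(1) by (simp add: chern_simons_higgs_solution_def)
  moreover have "0 \<le> 4 * pi * (\<Sum>j = 1..N. dirac \<mu> (p j) m)"
    using dirac_sum_nonneg[OF m(1)] by simp
  ultimately have "lam * exp (u m) * (exp (u m) - 1) \<le> 0" by linarith
  then have "u m \<le> 0" using lam by (simp add: mult_le_0_iff)
  with m(2)[OF x] show ?thesis by simp
qed

text \<open>Since \<open>u x\<close> is nonpositive, \<open>exp (u x)\<close> and
  \<open>1 - exp (u x)\<close> both lie between 0 and 1; the Dirac terms only raise the
  Laplacian.\<close>

lemma laplacian_solution_ge:
  assumes sol: "chern_simons_higgs_solution G \<omega> \<mu> N p lam u" and lam: "lam > 0" and x: "x \<in> pverts G"
  shows "- lam \<le> laplacian G \<omega> \<mu> u x"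
proof -
  have "exp (u x) * (1 - exp (u x)) \<le> 1 * 1"
    using solution_nonpos[OF assms] by (intro mult_mono) auto
  then have "lam * (exp (u x) * (1 - exp (u x))) \<le> lam * 1"
    using lam by (intro mult_left_mono) auto
  moreover have "0 \<le> 4 * pi * (\<Sum>j = 1..N. dirac \<mu> (p j) x)"
    using dirac_sum_nonneg[OF x] by simp
  moreover have "laplacian G \<omega> \<mu> u x
      = 4 * pi * (\<Sum>j = 1..N. dirac \<mu> (p j) x) - lam * (exp (u x) * (1 - exp (u x)))"
    using sol x by (simp add: chern_simons_higgs_solution_def right_diff_distrib)
  ultimately show ?thesis by linarith
qed

text \<open>Integrating the equation removes the Laplacian, and every Dirac mass contributes
  1.\<close>

lemma integral_solution:
  assumes sol: "chern_simons_higgs_solution G \<omega> \<mu> N p lam u"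
    and p: "\<And>j. j \<in> {1..N} \<Longrightarrow> p j \<in> pverts G"
  shows "lam * (\<Sum>x\<in>pverts G. \<mu> x * (exp (u x) * (1 - exp (u x)))) = 4 * pi * real N"
proof -
  have "(\<Sum>x\<in>pverts G. \<mu> x * (\<Sum>j = 1..N. dirac \<mu> (p j) x))
      = (\<Sum>j = 1..N. \<Sum>x\<in>pverts G. \<mu> x * dirac \<mu> (p j) x)"
    unfolding sum_distrib_left by (rule sum.swap)
  also have "\<dots> = real N" using p by (simp add: integral_dirac)
  finally have dirac: "(\<Sum>x\<in>pverts G. \<mu> x * (\<Sum>j = 1..N. dirac \<mu> (p j) x)) = real N" .
  have "0 = (\<Sum>x\<in>pverts G. \<mu> x * laplacian G \<omega> \<mu> u x)"
    by (simp add: integral_laplacian)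
  also have "\<dots> = (\<Sum>x\<in>pverts G. 4 * pi * (\<mu> x * (\<Sum>j = 1..N. dirac \<mu> (p j) x))
      - lam * (\<mu> x * (exp (u x) * (1 - exp (u x)))))"
  proof (intro sum.cong refl)
    fix x assume "x \<in> pverts G"
    then have eq: "laplacian G \<omega> \<mu> u x
        = lam * exp (u x) * (exp (u x) - 1) + 4 * pi * (\<Sum>j = 1..N. dirac \<mu> (p j) x)"
      using sol by (simp add: chern_simons_higgs_solution_def)
    show "\<mu> x * laplacian G \<omega> \<mu> u x = 4 * pi * (\<mu> x * (\<Sum>j = 1..N. dirac \<mu> (p j) x))
      - lam * (\<mu> x * (exp (u x) * (1 - exp (u x))))"
      unfolding eq by (simp add: algebra_simps)
  qed
  also have "\<dots> = 4 * pi * real N - lam * (\<Sum>x\<in>pverts G. \<mu> x * (exp (u x) * (1 - exp (u x))))"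
    by (simp only: sum_subtractf dirac flip: sum_distrib_left)
  finally show ?thesis by simp
qed

lemma solution_not_uniformly_small:
  assumes sol: "chern_simons_higgs_solution G \<omega> \<mu> N p lam u"
    and N: "N \<ge> 1" and p: "\<And>j. j \<in> {1..N} \<Longrightarrow> p j \<in> pverts G"
    and lam: "0 < lam" "lam \<le> L"
  shows "\<exists>x\<in>pverts G. ln (4 * pi * real N / (L * volume G \<mu>)) \<le> u x"
proof (rule ccontr)
  \<comment> \<open>Chosen so that \<open>L * (volume G \<mu> * ?c)\<close> is the total Dirac mass
    \<open>4 * pi * real N\<close>. If \<open>exp u\<close> were below \<open>?c\<close> everywhere,
    the nonlinear term could not integrate to that mass.\<close>
  let ?c = "4 * pi * real N / (L * volume G \<mu>)"
  assume "\<not> ?thesis"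
  then have less: "u x < ln ?c" if "x \<in> pverts G" for x using that by force
  have c: "?c > 0" using N lam volume_pos by simp
  have "(\<Sum>x\<in>pverts G. \<mu> x * (exp (u x) * (1 - exp (u x)))) < (\<Sum>x\<in>pverts G. \<mu> x * ?c)"
  proof (rule sum_strict_mono[OF pair_finite_verts pverts_nonempty])
    fix x assume x: "x \<in> pverts G"
    have "exp (u x) * (1 - exp (u x)) \<le> exp (u x) * 1"
      by (intro mult_left_mono) auto
    also have "\<dots> < ?c" using exp_less_mono[OF less[OF x]] c by (simp only: exp_ln mult_1_right)
    finally show "\<mu> x * (exp (u x) * (1 - exp (u x))) < \<mu> x * ?c"
      using measure_pos[OF x] by (rule mult_strict_left_mono)
  qed
  then have "lam * (\<Sum>x\<in>pverts G. \<mu> x * (exp (u x) * (1 - exp (u x)))) < lam * (volume G \<mu> * ?c)"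
    using lam(1) unfolding volume_def sum_distrib_right by (rule mult_strict_left_mono)
  also have "\<dots> \<le> L * (volume G \<mu> * ?c)"
    using lam c volume_pos by (intro mult_right_mono) (auto simp: less_imp_le)
  also have "\<dots> = 4 * pi * real N" using lam volume_pos by simp
  finally show False using integral_solution[OF sol p] by simp
qed

lemma solutions_uniformly_bounded:
  assumes "N \<ge> 1" and "\<And>j. j \<in> {1..N} \<Longrightarrow> p j \<in> pverts G"
  shows "\<exists>B. \<forall>lam u. 0 < lam \<longrightarrow> lam \<le> L \<longrightarrow> chern_simons_higgs_solution G \<omega> \<mu> N p lam u
    \<longrightarrow> (\<forall>x\<in>pverts G. \<bar>u x\<bar> \<le> B)"
proof -
  obtain B where B: "\<And>u. (\<forall>z\<in>pverts G. u z \<le> 0 \<and> - L \<le> laplacian G \<omega> \<mu> u z) \<Longrightarrow>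
      (\<exists>x\<in>pverts G. - (- ln (4 * pi * real N / (L * volume G \<mu>))) \<le> u x)
      \<Longrightarrow> (\<forall>y\<in>pverts G. - B \<le> u y)"
    using uniform_lower_bound[of L "- ln (4 * pi * real N / (L * volume G \<mu>))"] by blast
  show ?thesis
  proof (intro exI allI impI ballI)
    fix lam u x
    assume lam: "0 < lam" "lam \<le> L" and sol: "chern_simons_higgs_solution G \<omega> \<mu> N p lam u"
      and x: "x \<in> pverts G"
    have "\<forall>z\<in>pverts G. u z \<le> 0 \<and> - L \<le> laplacian G \<omega> \<mu> u z"
      using solution_nonpos[OF sol lam(1)] laplacian_solution_ge[OF sol lam(1)] lam(2) by force
    moreover have "\<exists>x\<in>pverts G. - (- ln (4 * pi * real N / (L * volume G \<mu>))) \<le> u x"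
      using solution_not_uniformly_small[OF sol assms lam] by simp
    ultimately have "- B \<le> u x" using B x by blast
    then show "\<bar>u x\<bar> \<le> B" using solution_nonpos[OF sol lam(1) x] by simp
  qed
qed

section \<open>Passage to the limit at the critical value\<close>

text \<open>At each vertex both sides depend continuously on the parameter and on finitely many
  values of the function, so pointwise convergence on the vertices suffices.\<close>

lemma solution_limit:
  assumes sol: "\<And>n. chern_simons_higgs_solution G \<omega> \<mu> N p (l n) (f n)"
    and l: "l \<longlonglongrightarrow> lam"
    and f: "\<And>x. x \<in> pverts G \<Longrightarrow> (\<lambda>n. f n x) \<longlonglongrightarrow> u x"
  shows "chern_simons_higgs_solution G \<omega> \<mu> N p lam u"
  unfolding chern_simons_higgs_solution_def
proof
  fix x assume x: "x \<in> pverts G"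
  let ?d = "4 * pi * (\<Sum>j = 1..N. dirac \<mu> (p j) x)"
  have "(\<lambda>n. laplacian G \<omega> \<mu> (f n) x) \<longlonglongrightarrow> laplacian G \<omega> \<mu> u x"
    unfolding laplacian_def using f x by (intro tendsto_intros) (auto dest: in_arcsD2)
  moreover have "(\<lambda>n. laplacian G \<omega> \<mu> (f n) x)
      = (\<lambda>n. l n * exp (f n x) * (exp (f n x) - 1) + ?d)"
    using sol x by (simp add: chern_simons_higgs_solution_def)
  moreover have "(\<lambda>n. l n * exp (f n x) * (exp (f n x) - 1) + ?d)
      \<longlonglongrightarrow> lam * exp (u x) * (exp (u x) - 1) + ?d"
    by (intro tendsto_intros l f x)
  ultimately show "laplacian G \<omega> \<mu> u x = lam * exp (u x) * (exp (u x) - 1) + ?d"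
    by (metis LIMSEQ_unique)
qed

end

theorem theorem1p2:
  fixes G :: "'a pair_pre_digraph"
    and \<omega> :: "'a \<Rightarrow> 'a \<Rightarrow> real"
    and \<mu> :: "'a \<Rightarrow> real"
    and N :: nat
    and p :: "nat \<Rightarrow> 'a"
    and lam_c :: real
  assumes "connected_weighted_graph G \<omega> \<mu>"
    and "N \<ge> 1"
    and "\<And>j. j \<in> {1..N} \<Longrightarrow> p j \<in> pverts G"
    and "inj_on p {1..N}"
    and "is_critical_value G \<omega> \<mu> N p lam_c"
  shows "\<exists>u. chern_simons_higgs_solution G \<omega> \<mu> N p lam_c u"
proof -
  interpret connected_weighted_graph G \<omega> \<mu> by fact
  \<comment> \<open>Positivity of \<open>lam_c\<close> keeps all parameters \<open>l n\<close>
    positive, as the a priori bounds require.\<close>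
  have "0 < 16 * pi * real N / volume G \<mu>" using assms(2) volume_pos by simp
  then have pos: "lam_c > 0" using assms(5) by (simp add: is_critical_value_def)
  \<comment> \<open>Approach from above, where solutions exist; all values stay within
    \<open>lam_c + 1\<close>, which serves as \<open>L\<close>.\<close>
  define l where "l n = lam_c + 1 / real (Suc n)" for n
  have l: "0 < l n" "lam_c < l n" "l n \<le> lam_c + 1" for n
    using pos by (simp_all add: l_def add_pos_pos)
  have l_lim: "l \<longlonglongrightarrow> lam_c"
    using tendsto_add[OF tendsto_const LIMSEQ_inverse_real_of_nat, of lam_c]
    by (simp add: l_def[abs_def] inverse_eq_divide)
  have "\<forall>n. \<exists>u. chern_simons_higgs_solution G \<omega> \<mu> N p (l n) u"
    using assms(5) l(2) unfolding is_critical_value_def by blast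
  then obtain f where f: "\<And>n. chern_simons_higgs_solution G \<omega> \<mu> N p (l n) (f n)"
    by metis
  have "\<exists>B. \<forall>lam u. 0 < lam \<longrightarrow> lam \<le> lam_c + 1 \<longrightarrow>
      chern_simons_higgs_solution G \<omega> \<mu> N p lam u \<longrightarrow> (\<forall>x\<in>pverts G. \<bar>u x\<bar> \<le> B)"
    using assms(2,3) by (rule solutions_uniformly_bounded)
  then obtain B where "\<forall>lam u. 0 < lam \<longrightarrow> lam \<le> lam_c + 1 \<longrightarrow>
      chern_simons_higgs_solution G \<omega> \<mu> N p lam u \<longrightarrow> (\<forall>x\<in>pverts G. \<bar>u x\<bar> \<le> B)" ..
  then have "\<bar>f n x\<bar> \<le> B" if "x \<in> pverts G" for x n using l f that by blast
  then obtain r :: "nat \<Rightarrow> nat" where r: "strict_mono r" "\<And>x. x \<in> pverts G \<Longrightarrow> convergent (\<lambda>n. f (r n) x)"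
    using bounded_imp_convergent_subsequence_finite[OF pair_finite_verts, of f B] by blast
  \<comment> \<open>Outside \<open>pverts G\<close> the limit may fail to exist and
    \<open>lim\<close> is then arbitrary, but the equation never reads those values.\<close>
  have "chern_simons_higgs_solution G \<omega> \<mu> N p lam_c (\<lambda>x. lim (\<lambda>n. f (r n) x))"
  proof (rule solution_limit)
    show "chern_simons_higgs_solution G \<omega> \<mu> N p (l (r n)) (f (r n))" for n by (rule f)
    show "(\<lambda>n. l (r n)) \<longlonglongrightarrow> lam_c"
      using LIMSEQ_subseq_LIMSEQ[OF l_lim r(1)] by (simp add: o_def)
    show "(\<lambda>n. f (r n) x) \<longlonglongrightarrow> lim (\<lambda>n. f (r n) x)" if "x \<in> pverts G" for x
      using r(2)[OF that] by (simp add: convergent_LIMSEQ_iff)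
  qed
  then show ?thesis by blast
qed

end
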